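(* Let $N\ge1$, $m\in\mathbb R^N$, let $P\in\mathbb R^{N\times N}$ be symmetric positive definite, and let $\sigma_0,b>0$. Let $L\sim\mathcal N(m,P)$ be a random vector in $\mathbb R^N$ and let $$Z_0=\mathbf 1^TL+W_0,\qquad Z_j=L_j+W_j\quad(j=1,\dots,N),$$ where $W_0\sim\mathcal N(0,\sigma_0^2)$, $W_j\sim\mathrm{Lap}(b)$ for $j=1,\dots,N$, and $L,W_0,W_1,\dots,W_N$ are independent. Write $Z=(Z_1,\dots,Z_N)^T$. Then for every $z_0\in\mathbb R$ and $z\in\mathbb R^N$ the maximum a posteriori estimate of $L$ given $Z_0=z_0$, $Z=z$ is $$\hat L^{\mathrm{MAP}}(z_0,z)=\arg\min_{l\in\mathbb R^N}\ \frac{(z_0-\mathbf 1^Tl)^2}{2\sigma_0^2}+\frac12\left\|P^{-1/2}(l-m)\right\|_2^2+\frac1b\|z-l\|_1 .$$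
   Context: $\mathbf 1\in\mathbb R^N$ is the column vector of ones. $\mathrm{Lap}(b)$ is the zero-mean Laplace distribution with density $\frac{1}{2b}e^{-|w|/b}$. $\|\cdot\|_1$ and $\|\cdot\|_2$ are the usual vector norms and $P^{-1/2}$ is the inverse of the symmetric positive definite square root of $P$. The maximum a posteriori (MAP) estimate is defined by $$\hat L^{\mathrm{MAP}}(z_0,z):=\arg\max_{l\in\mathbb R^N}\ p_{Z_0,Z|L}(z_0,z|l)\,p_L(l),$$ where $p_L$ is the density of $L$ and $p_{Z_0,Z|L}(\cdot|l)$ is the conditional density of $(Z_0,Z)$ given $L=l$. *)

theory Defs
  imports "HOL-Probability.Probability"
begin

definition spd_matrix :: "real^'n^'n \<Rightarrow> bool" where
  "spd_matrix P \<longleftrightarrow> transpose P = P \<and> (\<forall>x. x \<noteq> 0 \<longrightarrow> 0 < x \<bullet> (P *v x))"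

definition spd_sqrt :: "real^'n^'n \<Rightarrow> real^'n^'n" where
  "spd_sqrt P = (THE S. spd_matrix S \<and> S ** S = P)"

definition norm_1 :: "real^'n \<Rightarrow> real" where
  "norm_1 x = (\<Sum>j\<in>UNIV. \<bar>x $ j\<bar>)"

(* For nondegenerate covariance P only. *)
definition multi_normal_density :: "real^'n \<Rightarrow> real^'n^'n \<Rightarrow> real^'n \<Rightarrow> real" where
  "multi_normal_density m P x =
     exp (- ((x - m) \<bullet> (matrix_inv P *v (x - m))) / 2) / sqrt ((2 * pi) ^ CARD('n) * det P)"

definition laplace_density :: "real \<Rightarrow> real \<Rightarrow> real" where
  "laplace_density b w = exp (- \<bar>w\<bar> / b) / (2 * b)"

(* Densities are determined only almost everywhere, whereas a MAP estimate evaluates them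
   pointwise.  The continuous version is meant throughout; it is unique for the prior, and
   the conditional version is unique as soon as the law of X has full support. *)

definition prior_density :: "'a measure \<Rightarrow> ('a \<Rightarrow> 'x::euclidean_space) \<Rightarrow> 'x \<Rightarrow> real" where
  "prior_density M X = (THE p. continuous_on UNIV p \<and> (\<forall>x. 0 \<le> p x) \<and>
     distributed M lborel X (\<lambda>x. ennreal (p x)))"

(* "k x" is the density of a regular conditional distribution of Y given X = x. *)
definition is_cond_density ::
    "'a measure \<Rightarrow> ('a \<Rightarrow> 'x::euclidean_space) \<Rightarrow> ('a \<Rightarrow> 'y::euclidean_space) \<Rightarrow>
      ('x \<Rightarrow> 'y \<Rightarrow> real) \<Rightarrow> bool" where
  "is_cond_density M X Y k \<longleftrightarrow>
     case_prod k \<in> borel_measurable (borel \<Otimes>\<^sub>M borel) \<and>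
     (\<forall>x y. 0 \<le> k x y) \<and>
     (\<forall>x. (\<integral>\<^sup>+ y. ennreal (k x y) \<partial>lborel) = 1) \<and>
     (\<forall>A\<in>sets borel. \<forall>B\<in>sets borel.
        emeasure M {\<omega> \<in> space M. X \<omega> \<in> A \<and> Y \<omega> \<in> B} =
        (\<integral>\<^sup>+ x\<in>A. (\<integral>\<^sup>+ y\<in>B. ennreal (k x y) \<partial>lborel) \<partial>distr M borel X))"

definition cond_density ::
    "'a measure \<Rightarrow> ('a \<Rightarrow> 'x::euclidean_space) \<Rightarrow> ('a \<Rightarrow> 'y::euclidean_space) \<Rightarrow>
      'x \<Rightarrow> 'y \<Rightarrow> real" where
  "cond_density M X Y =
     (THE k. continuous_on UNIV (case_prod k) \<and> is_cond_density M X Y k)"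

definition MAP_objective ::
    "'a measure \<Rightarrow> ('a \<Rightarrow> 'x::euclidean_space) \<Rightarrow> ('a \<Rightarrow> 'y::euclidean_space) \<Rightarrow>
      'y \<Rightarrow> 'x \<Rightarrow> real" where
  "MAP_objective M X Y y x = cond_density M X Y x y * prior_density M X x"

definition MAP_estimate ::
    "'a measure \<Rightarrow> ('a \<Rightarrow> 'x::euclidean_space) \<Rightarrow> ('a \<Rightarrow> 'y::euclidean_space) \<Rightarrow>
      'y \<Rightarrow> 'x" where
  "MAP_estimate M X Y y = arg_max (MAP_objective M X Y y) (\<lambda>_. True)"

(* The sigma-algebras generated by L, W0 and the W j.  The option index is used because
   indep_vars requires all variables of the family to have the same value type. *)
definition source_events ::
    "'a measure \<Rightarrow> ('a \<Rightarrow> real^'n) \<Rightarrow> ('a \<Rightarrow> real) \<Rightarrow> ('n \<Rightarrow> 'a \<Rightarrow> real) \<Rightarrow>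
      'n option option \<Rightarrow> 'a set set" where
  "source_events M L W0 W i = (case i of
       None \<Rightarrow> sets (vimage_algebra (space M) L borel)
     | Some None \<Rightarrow> sets (vimage_algebra (space M) W0 borel)
     | Some (Some j) \<Rightarrow> sets (vimage_algebra (space M) (W j) borel))"

end

theory Submission
  imports Defs
begin

text \<open>
  The vector \<open>(W0, W)\<close> is independent of \<open>L\<close> and has the product density \<open>g\<close> of one normal and
  \<open>N\<close> Laplace factors.  The observation is \<open>Y = (W0, W) + T L\<close> with \<open>T l = (1 \<bullet> l, l)\<close>, so the
  conditional density of \<open>Y\<close> given \<open>L = l\<close> is \<open>y \<mapsto> g (y - T l)\<close>.  Multiplying by the normal
  prior gives \<open>C * exp (- J l)\<close> with a constant \<open>C > 0\<close>, where the exponent \<open>J\<close> is the criterion of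
  the theorem.  Hence the maximisers of the posterior are the minimisers of \<open>J\<close>.

  The densities in this argument are the unique continuous ones, so two such versions have to be
  compared.  Versions of a density agree almost everywhere, and continuous functions that agree
  almost everywhere are equal.  For the prior this is \<open>prior_density_eq\<close>.  A conditional density
  becomes an ordinary joint density once multiplied by the prior density, and this is everywhere
  positive, so the same reasoning determines it: \<open>cond_density_eq\<close>.  The joint law of the sources
  is obtained in \<open>joint_distributed_of_source_events\<close> and the shift by \<open>T\<close> is carried out in
  \<open>is_cond_density_additive_noise\<close>.

  On the side of linear algebra, \<open>spd_sqrt\<close> is given by a definite description, so existence and
  uniqueness of the positive definite square root are needed (\<open>spd_matrix_sqrt_exists\<close>,
  \<open>spd_matrix_sqrt_unique\<close>) before the quadratic form of the inverse of \<open>P\<close> can be read as a squared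
  norm.  Finally \<open>J\<close> is a nonnegative convex function plus a positive definite quadratic form:
  coercivity gives a minimiser and strict convexity makes it the only one
  (\<open>ex1_minimizer_convex_plus_quadratic\<close>).
\<close>

section \<open>Positive definite matrices and their square roots\<close>

lemma matrix_inv_eqI:
  fixes A B :: "real^'n^'n"
  assumes "A ** B = mat 1"
  shows "matrix_inv A = B"
proof -
  have BA: "B ** A = mat 1" using assms by (simp add: matrix_left_right_inverse)
  show ?thesis unfolding matrix_inv_def
  proof (rule some_equality)
    fix C assume "A ** C = mat 1 \<and> C ** A = mat 1"
    then show "C = B" by (metis BA matrix_mul_assoc matrix_mul_lid matrix_mul_rid)
  qed (use assms BA in auto)
qed

lemma spd_matrix_symmetric:
  assumes "spd_matrix P"
  shows "(P *v x) \<bullet> y = x \<bullet> (P *v y)"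
  using assms unfolding spd_matrix_def by (metis dot_lmul_matrix vector_transpose_matrix)

lemma symmetric_matrixI:
  fixes S :: "real^'n^'n"
  assumes "\<And>x y. (S *v x) \<bullet> y = x \<bullet> (S *v y)"
  shows "transpose S = S"
proof -
  have "transpose S *v x = S *v x" for x
  proof (rule vector_eq_ldot[THEN iffD1], rule allI)
    fix y
    show "y \<bullet> (transpose S *v x) = y \<bullet> (S *v x)"
      using assms[of y x] by (metis dot_lmul_matrix inner_commute transpose_matrix_vector)
  qed
  then show ?thesis by (simp add: matrix_eq)
qed

lemma spd_matrix_right_inverse:
  fixes P :: "real^'n^'n"
  assumes "spd_matrix P"
  shows "P ** matrix_inv P = mat 1"
proof -
  have "\<forall>x. P *v x = 0 \<longrightarrow> x = 0"
    using assms unfolding spd_matrix_def by (metis inner_zero_right less_irrefl)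
  then obtain B where "B ** P = mat 1" using matrix_left_invertible_ker by blast
  then have "P ** B = mat 1" by (simp add: matrix_left_right_inverse)
  then show ?thesis using matrix_inv_eqI by metis
qed

text \<open>
  The quadratic form attains a positive minimum on the compact unit sphere, and it is homogeneous
  of degree two.
\<close>

lemma spd_matrix_coercive:
  fixes P :: "real^'n^'n"
  assumes "spd_matrix P"
  obtains c where "0 < c" "\<And>x. c * (norm x)\<^sup>2 \<le> x \<bullet> (P *v x)"
proof -
  let ?S = "sphere (0::real^'n) 1"
  have "compact ?S" "?S \<noteq> {}" by auto
  moreover have "continuous_on ?S (\<lambda>x. x \<bullet> (P *v x))"
    by (intro continuous_intros matrix_vector_mult_linear_continuous_on)
  ultimately obtain u where u: "u \<in> ?S" "\<And>x. x \<in> ?S \<Longrightarrow> u \<bullet> (P *v u) \<le> x \<bullet> (P *v x)"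
    using continuous_attains_inf by metis
  show thesis
  proof
    have "u \<noteq> 0" using u(1) by auto
    then show "0 < u \<bullet> (P *v u)" using assms unfolding spd_matrix_def by blast
    fix x
    show "u \<bullet> (P *v u) * (norm x)\<^sup>2 \<le> x \<bullet> (P *v x)"
    proof (cases "x = 0")
      case False
      then have "u \<bullet> (P *v u) \<le> (x /\<^sub>R norm x) \<bullet> (P *v (x /\<^sub>R norm x))" by (intro u(2)) auto
      also have "\<dots> = (x \<bullet> (P *v x)) / (norm x)\<^sup>2"
        by (simp add: matrix_vector_mult_scaleR power2_eq_square field_simps)
      finally show ?thesis using False by (simp add: field_simps)
    qed auto
  qed
qed

text \<open>
  With \<open>A = S + T\<close> and \<open>D = S - T\<close> the hypothesis says that \<open>A\<close> and \<open>D\<close> anticommute.  Therefore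
  the trace of \<open>D A D\<close> equals its own negative.  Since \<open>D\<close> is symmetric and \<open>A\<close> positive
  definite, this trace is a sum of nonnegative terms, one for each column of \<open>D\<close>, and a term
  vanishes only if its column does.
\<close>

lemma spd_matrix_sqrt_unique:
  fixes S T :: "real^'n^'n"
  assumes S: "spd_matrix S" and T: "spd_matrix T" and eq: "S ** S = T ** T"
  shows "S = T"
proof -
  define A D where "A = S + T" and "D = S - T"
  have Dsym: "(D *v x) \<bullet> y = x \<bullet> (D *v y)" for x y
    unfolding D_def using spd_matrix_symmetric[OF S, of x y] spd_matrix_symmetric[OF T, of x y]
    by (simp add: matrix_vector_mult_diff_rdistrib inner_diff_left inner_diff_right)
  have "A *v (D *v x) + D *v (A *v x) = 0" for x
  proof -
    have "S *v (S *v x) = T *v (T *v x)" by (simp add: matrix_vector_mul_assoc eq)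
    then show ?thesis unfolding A_def D_def
      by (simp add: matrix_vector_mult_diff_rdistrib matrix_vector_mult_add_rdistrib
          matrix_vector_mult_diff_distrib matrix_vector_right_distrib)
  qed
  then have "A ** D + D ** A = 0"
    by (simp add: matrix_eq matrix_vector_mult_add_rdistrib matrix_vector_mul_assoc[symmetric])
  then have anti: "A ** D = - (D ** A)" by (simp add: eq_neg_iff_add_eq_0)
  have "trace (D ** (A ** D)) = trace ((A ** D) ** D)" by (rule trace_mul_sym)
  also have "\<dots> = - trace (D ** (A ** D))"
  proof -
    have "(- (D ** A)) ** D = - (D ** (A ** D))"
      by (simp add: matrix_mul_assoc) (simp add: vec_eq_iff matrix_matrix_mult_def sum_negf)
    then show ?thesis by (simp add: anti) (simp add: trace_def sum_negf)
  qed
  finally have tr0: "trace (D ** (A ** D)) = 0" by simp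
  have diag: "(D ** (A ** D)) $ i $ i = (D *v axis i 1) \<bullet> (A *v (D *v axis i 1))" for i
  proof -
    have "(D ** (A ** D)) $ i $ i = axis i 1 \<bullet> ((D ** (A ** D)) *v axis i 1)"
      by (simp add: inner_axis' matrix_vector_mul_component inner_axis)
    then show ?thesis by (simp add: Dsym matrix_vector_mul_assoc)
  qed
  have pos: "x \<noteq> 0 \<Longrightarrow> 0 < x \<bullet> (A *v x)" for x
    using S T unfolding spd_matrix_def A_def
    by (simp add: matrix_vector_mult_add_rdistrib inner_add_right add_pos_pos)
  then have nn: "0 \<le> x \<bullet> (A *v x)" for x by (cases "x = 0") (auto intro: less_imp_le)
  have "D *v axis i 1 = 0" for i
  proof -
    have "(\<Sum>i\<in>UNIV. (D *v axis i 1) \<bullet> (A *v (D *v axis i 1))) = 0"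
      using tr0 by (simp add: trace_def diag)
    then have "(D *v axis i 1) \<bullet> (A *v (D *v axis i 1)) = 0"
      using nn by (simp add: sum_nonneg_eq_0_iff)
    then show ?thesis using pos by force
  qed
  then have "D = 0"
    by (simp add: vec_eq_iff matrix_vector_mul_component inner_axis)
  then show ?thesis by (simp add: D_def)
qed

text \<open>
  Scale \<open>P\<close> so that \<open>B = I - P / c\<close> has operator norm below one.  A fixed point \<open>X\<close> of
  \<open>X \<mapsto> (B + X\<^sup>2) / 2\<close> satisfies \<open>(I - X)\<^sup>2 = I - B = P / c\<close>, so \<open>sqrt c (I - X)\<close> is a square root
  of \<open>P\<close>.  The map is a contraction of the ball whose radius is the bound on the norm of \<open>B\<close>.
  Restricting it to the closed set of symmetric operators in that ball makes the fixed point
  symmetric, and \<open>I - X\<close> is positive definite because \<open>X\<close> has norm below one.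
\<close>

lemma spd_matrix_sqrt_exists:
  fixes P :: "real^'n^'n"
  assumes "spd_matrix P"
  obtains S where "spd_matrix S" "S ** S = P"
proof -
  define p where "p = Blinfun (\<lambda>x. P *v x)"
  have p[simp]: "blinfun_apply p x = P *v x" for x
    unfolding p_def by (simp add: bounded_linear_Blinfun_apply)
  obtain e where e: "0 < e" "\<And>x. e * (norm x)\<^sup>2 \<le> x \<bullet> (P *v x)"
    using spd_matrix_coercive[OF assms] by metis
  \<comment> \<open>The maximum with \<open>e\<close> keeps \<open>K\<close> positive and \<open>\<beta>\<close> real.\<close>
  define K where "K = max e (norm p)"
  have K: "0 < K" "e \<le> K" "norm (P *v x) \<le> K * norm x" for x
  proof -
    show "0 < K" "e \<le> K" using e by (auto simp: K_def)
    have "norm (P *v x) \<le> norm p * norm x" using norm_blinfun[of p x] by simp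
    also have "\<dots> \<le> K * norm x" by (intro mult_right_mono) (auto simp: K_def)
    finally show "norm (P *v x) \<le> K * norm x" .
  qed
  \<comment> \<open>This \<open>c\<close> minimises the bound \<open>1 - 2 e / c + (K / c)\<^sup>2\<close> on the squared norm of \<open>B\<close>;
    the minimum is \<open>\<beta>\<^sup>2\<close>.\<close>
  define c where "c = K\<^sup>2 / e"
  define \<beta> where "\<beta> = sqrt (1 - e\<^sup>2 / K\<^sup>2)"
  have c: "0 < c" using K e by (simp add: c_def)
  have q: "0 \<le> 1 - e\<^sup>2 / K\<^sup>2" "1 - e\<^sup>2 / K\<^sup>2 < 1"
    using K e by (auto simp: field_simps power_mono)
  then have \<beta>: "0 \<le> \<beta>" "\<beta> < 1" by (auto simp: \<beta>_def)
  define B where "B = id_blinfun - (1 / c) *\<^sub>R p"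
  have B[simp]: "blinfun_apply B x = x - (1 / c) *\<^sub>R (P *v x)" for x
    by (simp add: B_def blinfun.bilinear_simps)
  have nB: "norm B \<le> \<beta>"
  proof (rule norm_blinfun_bound[OF \<beta>(1)])
    fix x
    have "(norm (x - (1 / c) *\<^sub>R (P *v x)))\<^sup>2
        = (norm x)\<^sup>2 - 2 / c * (x \<bullet> (P *v x)) + (1/c)\<^sup>2 * (norm (P *v x))\<^sup>2"
      unfolding power2_norm_eq_inner
      by (simp add: inner_diff_left inner_diff_right inner_commute power2_eq_square field_simps)
    also have "\<dots> \<le> (norm x)\<^sup>2 - 2 / c * (e * (norm x)\<^sup>2) + (1/c)\<^sup>2 * (K * norm x)\<^sup>2"
      using c K(3)[of x] e(2)[of x]
      by (intro add_mono diff_mono mult_left_mono power_mono) auto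
    also have "\<dots> = (1 - e\<^sup>2 / K\<^sup>2) * (norm x)\<^sup>2"
      using K(1) e(1) by (simp add: c_def field_simps power2_eq_square)
    also have "\<dots> = (\<beta> * norm x)\<^sup>2"
      using q by (simp add: \<beta>_def power_mult_distrib)
    finally have "(norm (blinfun_apply B x))\<^sup>2 \<le> (\<beta> * norm x)\<^sup>2" by simp
    then show "norm (blinfun_apply B x) \<le> \<beta> * norm x"
      by (rule power2_le_imp_le) (simp add: \<beta>)
  qed
  have Bsym: "blinfun_apply B x \<bullet> y = x \<bullet> blinfun_apply B y" for x y
    by (simp add: inner_diff_left inner_diff_right spd_matrix_symmetric[OF assms])
  define G where "G X = (1/2) *\<^sub>R (B + (X o\<^sub>L X))" for X
  define C where "C = {X :: (real^'n) \<Rightarrow>\<^sub>L (real^'n). norm X \<le> \<beta> \<and>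
    (\<forall>x y. blinfun_apply X x \<bullet> y = x \<bullet> blinfun_apply X y)}"
  have "\<exists>!X\<in>C. G X = X"
  proof (rule Banach_fix[OF complete_eq_closed[THEN iffD2] _ \<beta>])
    show "closed C" unfolding C_def
      by (intro closed_Collect_conj closed_Collect_all closed_Collect_eq closed_Collect_le
          continuous_intros)
    show "C \<noteq> {}" using nB Bsym by (auto simp: C_def)
    show "G ` C \<subseteq> C"
    proof (intro image_subsetI)
      fix X assume X: "X \<in> C"
      have "norm (X o\<^sub>L X) \<le> \<beta> * \<beta>"
        using X norm_blinfun_compose[of X X] mult_mono[of "norm X" \<beta> "norm X" \<beta>] \<beta>
        by (auto simp: C_def)
      also have "\<dots> \<le> \<beta>" using \<beta> by (simp add: mult_left_le)
      finally have "norm (B + (X o\<^sub>L X)) \<le> 2 * \<beta>" using nB by norm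
      then have "norm (G X) \<le> \<beta>" by (simp add: G_def)
      then show "G X \<in> C" using X Bsym
        by (auto simp: C_def G_def blinfun.bilinear_simps inner_add_left inner_add_right)
    qed
    fix X Y assume X: "X \<in> C" and Y: "Y \<in> C"
    \<comment> \<open>Difference of squares for noncommuting operators.\<close>
    have "(X o\<^sub>L X) - (Y o\<^sub>L Y) = (X o\<^sub>L (X - Y)) + ((X - Y) o\<^sub>L Y)"
      by (rule blinfun_eqI) (simp add: blinfun.bilinear_simps)
    then have "norm ((X o\<^sub>L X) - (Y o\<^sub>L Y)) \<le> norm X * norm (X - Y) + norm (X - Y) * norm Y"
      using norm_blinfun_compose[of X "X - Y"] norm_blinfun_compose[of "X - Y" Y]
      by (smt (verit) norm_triangle_ineq)
    also have "\<dots> \<le> \<beta> * norm (X - Y) + norm (X - Y) * \<beta>"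
      using X Y by (intro add_mono mult_mono) (auto simp: C_def \<beta>)
    finally have "norm ((X o\<^sub>L X) - (Y o\<^sub>L Y)) \<le> 2 * (\<beta> * norm (X - Y))" by simp
    moreover have "G X - G Y = (1/2) *\<^sub>R ((X o\<^sub>L X) - (Y o\<^sub>L Y))"
      by (simp add: G_def algebra_simps)
    ultimately show "dist (G X) (G Y) \<le> \<beta> * dist X Y" by (simp add: dist_norm)
  qed
  then obtain X where X: "X \<in> C" "G X = X" by auto
  define S where "S = matrix (\<lambda>x. sqrt c *\<^sub>R (x - blinfun_apply X x))"
  have "linear (\<lambda>x. sqrt c *\<^sub>R (x - blinfun_apply X x))"
    by (intro linear_compose_scale_right linear_compose_sub
        bounded_linear.linear[OF blinfun.bounded_linear_right] linear_ident)
  then have S: "S *v x = sqrt c *\<^sub>R (x - blinfun_apply X x)" for x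
    unfolding S_def by (rule fun_cong[OF matrix_vector_mul(2)])
  have half: "u = (1/2) *\<^sub>R w \<Longrightarrow> 2 *\<^sub>R u = w" for u w :: "real^'n" by simp
  have "S *v (S *v x) = P *v x" for x
  proof -
    have "blinfun_apply X x = (1/2) *\<^sub>R (x - (1 / c) *\<^sub>R (P *v x) + blinfun_apply X (blinfun_apply X x))"
      using arg_cong[OF X(2), of "\<lambda>F. blinfun_apply F x"]
      by (simp add: G_def blinfun.bilinear_simps)
    then have "2 *\<^sub>R blinfun_apply X x = x - (1 / c) *\<^sub>R (P *v x) + blinfun_apply X (blinfun_apply X x)"
      by (rule half)
    then have "x - 2 *\<^sub>R blinfun_apply X x + blinfun_apply X (blinfun_apply X x) = (1 / c) *\<^sub>R (P *v x)"
      by simp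
    then have *: "c *\<^sub>R (x - 2 *\<^sub>R blinfun_apply X x + blinfun_apply X (blinfun_apply X x)) = P *v x"
      using c by simp
    define d where "d = x - 2 *\<^sub>R blinfun_apply X x + blinfun_apply X (blinfun_apply X x)"
    have "d = (x - blinfun_apply X x) - (blinfun_apply X x - blinfun_apply X (blinfun_apply X x))"
      by (simp add: d_def scaleR_2)
    then have "S *v (S *v x) = sqrt c *\<^sub>R (sqrt c *\<^sub>R d)"
      by (simp only: S blinfun.diff_right blinfun.scaleR_right scaleR_diff_right)
    also have "\<dots> = c *\<^sub>R d" using c by simp
    finally show ?thesis by (simp only: d_def *)
  qed
  then have "S ** S = P" by (simp add: matrix_eq matrix_vector_mul_assoc[symmetric])
  moreover have "spd_matrix S" unfolding spd_matrix_def
  proof (intro conjI allI impI)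
    show "transpose S = S"
      using X(1) by (intro symmetric_matrixI) (auto simp: S C_def inner_diff_left inner_diff_right)
    fix x :: "real^'n" assume "x \<noteq> 0"
    have "x \<bullet> blinfun_apply X x \<le> norm x * norm (blinfun_apply X x)" by (rule norm_cauchy_schwarz)
    also have "\<dots> \<le> norm x * (\<beta> * norm x)"
      using norm_blinfun[of X x] mult_right_mono[of "norm X" \<beta> "norm x"] X(1)
      by (intro mult_left_mono) (auto simp: C_def)
    also have "\<dots> < norm x * norm x" using \<beta> \<open>x \<noteq> 0\<close> by simp
    also have "\<dots> = x \<bullet> x" by (simp add: dot_square_norm power2_eq_square)
    finally show "0 < x \<bullet> (S *v x)" using c by (simp add: S inner_diff_right)
  qed
  ultimately show thesis using that by blast
qed

lemma spd_sqrt_properties: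
  assumes "spd_matrix P"
  shows "spd_matrix (spd_sqrt P)" "spd_sqrt P ** spd_sqrt P = P"
proof -
  have "\<exists>!S. spd_matrix S \<and> S ** S = P"
    using spd_matrix_sqrt_exists[OF assms] spd_matrix_sqrt_unique by metis
  then have "spd_matrix (spd_sqrt P) \<and> spd_sqrt P ** spd_sqrt P = P"
    unfolding spd_sqrt_def by (rule theI')
  then show "spd_matrix (spd_sqrt P)" "spd_sqrt P ** spd_sqrt P = P" by auto
qed

lemma norm_inverse_sqrt_eq_quadratic_form:
  fixes P :: "real^'n^'n"
  assumes "spd_matrix P"
  shows "(norm (matrix_inv (spd_sqrt P) *v x))\<^sup>2 = x \<bullet> (matrix_inv P *v x)"
proof -
  define S where "S = spd_sqrt P"
  define R where "R = matrix_inv S"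
  have S: "spd_matrix S" "S ** S = P" using spd_sqrt_properties[OF assms] by (auto simp: S_def)
  have SR: "S ** R = mat 1" using spd_matrix_right_inverse[OF S(1)] by (simp add: R_def)
  have "P ** (R ** R) = S ** (S ** R) ** R" by (simp add: S(2)[symmetric] matrix_mul_assoc)
  also have "\<dots> = mat 1" by (simp add: SR)
  finally have Pinv: "matrix_inv P = R ** R" by (rule matrix_inv_eqI)
  have SRx: "S *v (R *v y) = y" for y by (simp add: matrix_vector_mul_assoc SR)
  have "(norm (R *v x))\<^sup>2 = (R *v x) \<bullet> (S *v (R *v (R *v x)))"
    by (simp add: SRx power2_norm_eq_inner)
  also have "\<dots> = x \<bullet> (R *v (R *v x))"
    using spd_matrix_symmetric[OF S(1), of "R *v x" "R *v (R *v x)"] by (simp add: SRx)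
  finally show ?thesis by (simp add: Pinv R_def S_def matrix_vector_mul_assoc)
qed

text \<open>
  The determinant is the square of that of the square root, and it is nonzero by invertibility.
\<close>

lemma spd_matrix_det_pos:
  fixes P :: "real^'n^'n"
  assumes "spd_matrix P"
  shows "0 < det P"
proof -
  have "det P * det (matrix_inv P) = 1"
    by (metis spd_matrix_right_inverse[OF assms] det_I det_mul)
  moreover have "det P = det (spd_sqrt P) * det (spd_sqrt P)"
    by (metis spd_sqrt_properties(2)[OF assms] det_mul)
  ultimately show ?thesis by (metis mult_zero_left not_real_square_gt_zero zero_neq_one)
qed

section \<open>Minimisers of a convex function plus a quadratic form\<close>

text \<open>
  As \<open>h\<close> is nonnegative and \<open>A\<close> has a left inverse, the sublevel set of \<open>m\<close> is bounded, hence
  compact, and the continuous objective attains its minimum there.  At the midpoint of two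
  minimisers the parallelogram law gains \<open>(norm (A *v (u - v)))\<^sup>2 / 8\<close> over the average of
  their values, so \<open>A\<close> maps them to the same point and they coincide.
\<close>

lemma ex1_minimizer_convex_plus_quadratic:
  fixes A :: "real^'n^'n" and h :: "real^'n \<Rightarrow> real"
  assumes cvx: "convex_on UNIV h" and nn: "\<And>x. 0 \<le> h x"
    and BA: "B ** A = mat 1"
  shows "\<exists>!x. is_arg_min (\<lambda>x. h x + 1 / 2 * (norm (A *v (x - m)))\<^sup>2) (\<lambda>_. True) x"
proof -
  define J where "J x = h x + 1 / 2 * (norm (A *v (x - m)))\<^sup>2" for x
  have inv: "B *v (A *v x) = x" for x by (simp add: matrix_vector_mul_assoc BA)
  have contJ: "continuous_on UNIV J"
    unfolding J_def using convex_on_continuous[OF open_UNIV cvx]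
    by (intro continuous_intros continuous_on_compose2[OF matrix_vector_mult_linear_continuous_on[of UNIV A]])
      auto
  obtain K where K: "\<And>x. norm (B *v x) \<le> norm x * K"
    using bounded_linear.nonneg_bounded[OF matrix_vector_mul_bounded_linear[of B]] by blast
  let ?S = "{x. J x \<le> J m}"
  have "closed ?S"
    using contJ by (intro closed_Collect_le continuous_intros) auto
  moreover have "bounded ?S"
  proof (rule bounded_subset[OF bounded_cball])
    show "?S \<subseteq> cball m (sqrt (2 * J m) * \<bar>K\<bar>)"
    proof
      fix x assume "x \<in> ?S"
      then have "(norm (A *v (x - m)))\<^sup>2 \<le> 2 * J m" using nn[of x] by (simp add: J_def)
      then have "norm (A *v (x - m)) \<le> sqrt (2 * J m)" by (rule real_le_rsqrt)
      then have "norm (A *v (x - m)) * \<bar>K\<bar> \<le> sqrt (2 * J m) * \<bar>K\<bar>"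
        by (rule mult_right_mono) simp
      moreover have "norm (x - m) \<le> norm (A *v (x - m)) * \<bar>K\<bar>"
        using K[of "A *v (x - m)"] mult_left_mono[OF abs_ge_self[of K] norm_ge_zero[of "A *v (x - m)"]]
        unfolding inv by linarith
      ultimately show "x \<in> cball m (sqrt (2 * J m) * \<bar>K\<bar>)"
        by (simp add: dist_norm norm_minus_commute)
    qed
  qed
  ultimately have "compact ?S" by (simp add: compact_eq_bounded_closed)
  then obtain u where u: "u \<in> ?S" "\<And>x. x \<in> ?S \<Longrightarrow> J u \<le> J x"
    using continuous_attains_inf[of ?S J] continuous_on_subset[OF contJ] by blast
  have umin: "J u \<le> J x" for x
  proof (cases "x \<in> ?S")
    case False
    then show ?thesis using u(1) by simp
  qed (rule u(2))
  have "v = u" if v: "\<And>x. J v \<le> J x" for v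
  proof -
    define w where "w = (1/2) *\<^sub>R u + (1/2) *\<^sub>R v"
    define p q where "p = A *v (u - m)" and "q = A *v (v - m)"
    have A_w: "A *v (w - m) = (1/2) *\<^sub>R (p + q)"
    proof -
      have "w - m = (1/2) *\<^sub>R ((u - m) + (v - m))" by (simp add: w_def vec_eq_iff field_simps)
      then show ?thesis unfolding p_def q_def by (simp only: matrix_vector_mult_scaleR matrix_vector_right_distrib)
    qed
    have "h w \<le> (h u + h v) / 2"
      using convex_onD[OF cvx, of "1/2" u v] by (simp add: w_def algebra_simps)
    moreover have "(norm ((1/2) *\<^sub>R (p + q)))\<^sup>2 = (norm p)\<^sup>2 / 2 + (norm q)\<^sup>2 / 2 - (norm (p - q))\<^sup>2 / 4"
      unfolding power2_norm_eq_inner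
      by (simp add: inner_add_left inner_add_right inner_diff_left inner_diff_right inner_commute
          diff_divide_distrib add_divide_distrib)
    ultimately have "J w \<le> (J u + J v) / 2 - (norm (p - q))\<^sup>2 / 8"
      unfolding J_def A_w p_def[symmetric] q_def[symmetric] by argo
    moreover have "J u \<le> J w" "J v \<le> J w" "J u = J v" using umin v by (auto intro: antisym)
    ultimately have "(norm (p - q))\<^sup>2 \<le> 0" by argo
    then have "p = q" by simp
    then show ?thesis unfolding p_def q_def by (metis inv diff_add_cancel)
  qed
  with umin have "\<exists>!u. \<forall>x. J u \<le> J x" by blast
  then show ?thesis by (simp add: is_arg_min_def not_less J_def)
qed

lemma convex_norm_1: "convex_on UNIV (\<lambda>l. norm_1 (z - l :: real^'n))"
proof (rule convex_onI)
  fix t :: real and x y :: "real^'n" assume t: "0 < t" "t < 1"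
  have "\<bar>z$j - ((1 - t) * x$j + t * y$j)\<bar> \<le> (1 - t) * \<bar>z$j - x$j\<bar> + t * \<bar>z$j - y$j\<bar>" for j
  proof -
    have "z$j - ((1 - t) * x$j + t * y$j) = (1 - t) * (z$j - x$j) + t * (z$j - y$j)"
      by (simp add: algebra_simps)
    then show ?thesis using t by (metis abs_mult abs_of_pos abs_triangle_ineq diff_gt_0_iff_gt)
  qed
  then show "norm_1 (z - ((1 - t) *\<^sub>R x + t *\<^sub>R y)) \<le> (1 - t) * norm_1 (z - x) + t * norm_1 (z - y)"
    by (simp add: norm_1_def sum_distrib_left flip: sum.distrib) (intro sum_mono, simp)
qed simp

lemma convex_square_affine: "convex_on UNIV (\<lambda>l. (a - v \<bullet> l)\<^sup>2 :: real)"
proof (rule convex_onI)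
  fix t :: real and x y :: 'a assume t: "0 < t" "t < 1"
  have "(a - v \<bullet> ((1 - t) *\<^sub>R x + t *\<^sub>R y))\<^sup>2
      = (1 - t) * (a - v \<bullet> x)\<^sup>2 + t * (a - v \<bullet> y)\<^sup>2 - t * (1 - t) * (v \<bullet> x - v \<bullet> y)\<^sup>2"
    by (simp add: inner_add_right power2_eq_square algebra_simps)
  then show "(a - v \<bullet> ((1 - t) *\<^sub>R x + t *\<^sub>R y))\<^sup>2 \<le> (1 - t) * (a - v \<bullet> x)\<^sup>2 + t * (a - v \<bullet> y)\<^sup>2"
    using t by simp
qed simp
section \<open>Continuous versions of densities\<close>

text \<open>
  The set where two continuous functions agree is closed, and a closed set of full measure is
  everything.
\<close>

lemma continuous_AE_lborel_eq:
  fixes f g :: "'a::euclidean_space \<Rightarrow> real"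
  assumes "continuous_on UNIV f" "continuous_on UNIV g" and ae: "AE x in lborel. f x = g x"
  shows "f = g"
proof
  fix x
  have "closed {x. f x = g x}" using assms by (intro closed_Collect_eq)
  moreover have "AE x in lebesgue. x \<in> {x. f x = g x}" using AE_completion[OF ae] by simp
  ultimately show "f x = g x" using mem_closed_if_AE_lebesgue by blast
qed

lemma prior_density_eq:
  assumes "prob_space M" and p: "continuous_on UNIV p" "\<And>x. 0 \<le> p x"
    and d: "distributed M lborel X (\<lambda>x. ennreal (p x))"
  shows "prior_density M X = p"
  unfolding prior_density_def
proof (rule the_equality)
  interpret prob_space M by fact
  fix q assume q: "continuous_on UNIV q \<and> (\<forall>x. 0 \<le> q x) \<and> distributed M lborel X (\<lambda>x. ennreal (q x))"
  then have "AE x in lborel. ennreal (q x) = ennreal (p x)"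
    using d by (intro distributed_unique) auto
  then have "AE x in lborel. q x = p x" by (rule eventually_mono) (use q p in auto)
  then show "q = p" using q p by (intro continuous_AE_lborel_eq) auto
qed (use assms in auto)

text \<open>
  This turns the uniqueness question for conditional densities into one for ordinary densities.
\<close>

lemma distributed_pair_of_cond_density:
  fixes X :: "'a \<Rightarrow> 'x::euclidean_space" and Y :: "'a \<Rightarrow> 'y::euclidean_space"
  assumes "prob_space M" and X: "distributed M lborel X f" and Y: "Y \<in> borel_measurable M"
    and k: "is_cond_density M X Y k"
  shows "distributed M lborel (\<lambda>\<omega>. (X \<omega>, Y \<omega>)) (\<lambda>(x, y). f x * ennreal (k x y))"
proof -
  interpret prob_space M by fact
  have [measurable]: "case_prod k \<in> borel_measurable (borel \<Otimes>\<^sub>M borel)"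
    using k by (simp add: is_cond_density_def)
  have [measurable]: "f \<in> borel_measurable borel" "X \<in> borel_measurable M"
    using distributed_borel_measurable[OF X] distributed_measurable[OF X] by simp_all
  have dX: "distr M borel X = density lborel f"
    using distributed_distr_eq_density[OF X] by (metis distr_cong sets_lborel)
  have "distributed M (lborel \<Otimes>\<^sub>M lborel) (\<lambda>\<omega>. (X \<omega>, Y \<omega>)) (\<lambda>(x, y). f x * ennreal (k x y))"
  proof (rule distributed_jointI)
    show "X \<in> M \<rightarrow>\<^sub>M lborel" "Y \<in> M \<rightarrow>\<^sub>M lborel" using Y by simp_all
    show "(\<lambda>(x, y). f x * ennreal (k x y)) \<in> borel_measurable (lborel \<Otimes>\<^sub>M lborel)" by measurable
    fix A :: "'x set" and B :: "'y set" assume "A \<in> sets lborel" "B \<in> sets lborel"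
    then have [measurable]: "A \<in> sets borel" "B \<in> sets borel" by simp_all
    have "emeasure M {\<omega> \<in> space M. X \<omega> \<in> A \<and> Y \<omega> \<in> B}
        = (\<integral>\<^sup>+x\<in>A. (\<integral>\<^sup>+y\<in>B. ennreal (k x y) \<partial>lborel) \<partial>density lborel f)"
      using k by (simp add: is_cond_density_def dX)
    also have "\<dots> = (\<integral>\<^sup>+x. f x * ((\<integral>\<^sup>+y\<in>B. ennreal (k x y) \<partial>lborel) * indicator A x) \<partial>lborel)"
      by (rule nn_integral_density) measurable
    also have "\<dots> = (\<integral>\<^sup>+x. (\<integral>\<^sup>+y. f x * ennreal (k x y) * indicator B y \<partial>lborel) * indicator A x \<partial>lborel)"
      by (intro nn_integral_cong) (simp add: mult.assoc nn_integral_cmult)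
    finally show "emeasure M {\<omega> \<in> space M. X \<omega> \<in> A \<and> Y \<omega> \<in> B} =
       (\<integral>\<^sup>+x. (\<integral>\<^sup>+y. (case (x, y) of (x, y) \<Rightarrow> f x * ennreal (k x y)) * indicator B y \<partial>lborel)
           * indicator A x \<partial>lborel)" by simp
  qed (auto intro: sigma_finite_lborel)
  then show ?thesis by (simp add: lborel_prod)
qed

text \<open>
  Two continuous conditional densities give, after multiplication by the density \<open>f\<close> of \<open>X\<close>, two
  densities of \<open>(X, Y)\<close>, which agree almost everywhere.  The positivity of \<open>f\<close> at every point allows
  it to be cancelled, and continuity removes the exceptional null set.
\<close>

lemma cond_density_eq:
  fixes X :: "'a \<Rightarrow> 'x::euclidean_space" and Y :: "'a \<Rightarrow> 'y::euclidean_space"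
  assumes "prob_space M" and X: "distributed M lborel X (\<lambda>x. ennreal (f x))"
    and f: "continuous_on UNIV f" "\<And>x. 0 < f x" and Y: "Y \<in> borel_measurable M"
    and k: "continuous_on UNIV (case_prod k)" "is_cond_density M X Y k"
  shows "cond_density M X Y = k"
  unfolding cond_density_def
proof (rule the_equality)
  interpret prob_space M by fact
  fix k' assume k': "continuous_on UNIV (case_prod k') \<and> is_cond_density M X Y k'"
  have "AE p in lborel. (case p of (x, y) \<Rightarrow> ennreal (f x) * ennreal (k' x y))
      = (case p of (x, y) \<Rightarrow> ennreal (f x) * ennreal (k x y))"
    by (rule distributed_unique[OF distributed_pair_of_cond_density distributed_pair_of_cond_density])
       (use assms k' in auto)
  moreover have "\<forall>x y. 0 \<le> k x y" "\<forall>x y. 0 \<le> k' x y" using k k' by (auto simp: is_cond_density_def)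
  moreover have "f x \<noteq> 0" "0 \<le> f x" for x using f(2)[of x] by simp_all
  ultimately have "AE p in lborel. case_prod k' p = case_prod k p"
    by (elim eventually_mono) (auto simp flip: ennreal_mult)
  then have "case_prod k' = case_prod k" using k k' by (intro continuous_AE_lborel_eq) auto
  then show "k' = k" by (metis curry_case_prod)
qed (use k in auto)

section \<open>Conditional density under additive independent noise\<close>

lemma nn_integral_lborel_shift:
  fixes f :: "'a::euclidean_space \<Rightarrow> ennreal"
  assumes [measurable]: "f \<in> borel_measurable borel"
  shows "(\<integral>\<^sup>+x. f (x + t) \<partial>lborel) = (\<integral>\<^sup>+x. f x \<partial>lborel)"
proof -
  have "lborel = distr lborel borel (\<lambda>x::'a. t + x)"
    using lborel_affine[of 1 t] by (simp add: density_1)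
  then have "(\<integral>\<^sup>+x. f x \<partial>lborel) = (\<integral>\<^sup>+x. f x \<partial>distr lborel borel (\<lambda>x::'a. t + x))" by simp
  also have "\<dots> = (\<integral>\<^sup>+x. f (t + x) \<partial>lborel)" by (rule nn_integral_distr) auto
  finally show ?thesis by (simp add: add.commute)
qed

text \<open>
  The product form of the joint density expresses that \<open>V\<close> is independent of \<open>X\<close> with density \<open>g\<close>.
  For fixed \<open>x\<close> the probability of the event \<open>V + T x \<in> B\<close> is, by translation invariance of
  Lebesgue measure, the integral of \<open>g (y - T x)\<close> over \<open>y \<in> B\<close>, and integrating over \<open>x\<close> gives the
  law of \<open>(X, Y)\<close>.
\<close>

lemma is_cond_density_additive_noise:
  fixes X :: "'a \<Rightarrow> 'x::euclidean_space" and V :: "'a \<Rightarrow> 'y::euclidean_space"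
  assumes "prob_space M" and X: "distributed M lborel X f"
    and XV: "distributed M lborel (\<lambda>\<omega>. (X \<omega>, V \<omega>)) (\<lambda>(x, v). f x * ennreal (g v))"
    and [measurable]: "g \<in> borel_measurable borel" "T \<in> borel_measurable borel"
    and g: "\<And>v. 0 \<le> g v" "(\<integral>\<^sup>+v. ennreal (g v) \<partial>lborel) = 1"
    and Y: "\<And>\<omega>. \<omega> \<in> space M \<Longrightarrow> Y \<omega> = V \<omega> + T (X \<omega>)"
  shows "is_cond_density M X Y (\<lambda>x y. g (y - T x))"
  unfolding is_cond_density_def
proof (intro conjI allI ballI)
  interpret prob_space M by fact
  have [measurable]: "f \<in> borel_measurable borel" "X \<in> borel_measurable M"
    using distributed_borel_measurable[OF X] distributed_measurable[OF X] by simp_all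
  have dX: "distr M borel X = density lborel f"
    using distributed_distr_eq_density[OF X] by (metis distr_cong sets_lborel)
  show "(\<lambda>(x, y). g (y - T x)) \<in> borel_measurable (borel \<Otimes>\<^sub>M borel)" by measurable
  show "0 \<le> g (y - T x)" for x y by (rule g)
  show "(\<integral>\<^sup>+y. ennreal (g (y - T x)) \<partial>lborel) = 1" for x
    using nn_integral_lborel_shift[of "\<lambda>v. ennreal (g v)" "- T x"] g(2) by simp
  fix A :: "'x set" and B :: "'y set" assume [measurable]: "A \<in> sets borel" "B \<in> sets borel"
  let ?C = "{(x, v). x \<in> A \<and> v + T x \<in> B}"
  have C[measurable]: "?C \<in> sets (borel \<Otimes>\<^sub>M borel)"
  proof -
    have "{p \<in> space (borel \<Otimes>\<^sub>M borel). fst p \<in> A \<and> snd p + T (fst p) \<in> B} \<in> sets (borel \<Otimes>\<^sub>M borel)"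
      by measurable
    then show ?thesis by (simp add: space_pair_measure case_prod_unfold)
  qed
  have C': "?C \<in> sets lborel" using C unfolding borel_prod sets_lborel .
  have "emeasure M {\<omega> \<in> space M. X \<omega> \<in> A \<and> Y \<omega> \<in> B}
      = emeasure M ((\<lambda>\<omega>. (X \<omega>, V \<omega>)) -` ?C \<inter> space M)"
    by (intro arg_cong[of _ _ "emeasure M"]) (auto simp: Y)
  also have "\<dots> = (\<integral>\<^sup>+p. (case p of (x, v) \<Rightarrow> f x * ennreal (g v)) * indicator ?C p \<partial>lborel)"
    by (rule distributed_emeasure[OF XV C'])
  also have "\<dots> = (\<integral>\<^sup>+p. f (fst p) * ennreal (g (snd p)) * indicator ?C p \<partial>(lborel \<Otimes>\<^sub>M lborel))"
    by (simp add: lborel_prod case_prod_beta)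
  also have "\<dots> = (\<integral>\<^sup>+x. \<integral>\<^sup>+v. f x * ennreal (g v) * indicator ?C (x, v) \<partial>lborel \<partial>lborel)"
    by (subst lborel.nn_integral_fst[symmetric]) auto
  also have "\<dots> = (\<integral>\<^sup>+x. f x * ((\<integral>\<^sup>+y\<in>B. ennreal (g (y - T x)) \<partial>lborel) * indicator A x) \<partial>lborel)"
  proof (rule nn_integral_cong)
    fix x
    have "(\<integral>\<^sup>+v. f x * ennreal (g v) * indicator ?C (x, v) \<partial>lborel)
        = (\<integral>\<^sup>+v. (f x * indicator A x) * (ennreal (g ((v + T x) - T x)) * indicator B (v + T x)) \<partial>lborel)"
      by (intro nn_integral_cong) (auto simp: indicator_def)
    also have "\<dots> = (f x * indicator A x) * (\<integral>\<^sup>+y\<in>B. ennreal (g (y - T x)) \<partial>lborel)"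
      by (subst nn_integral_lborel_shift[of "\<lambda>y. (f x * indicator A x) * (ennreal (g (y - T x)) * indicator B y)"])
         (auto simp: nn_integral_cmult)
    finally show "(\<integral>\<^sup>+v. f x * ennreal (g v) * indicator ?C (x, v) \<partial>lborel)
        = f x * ((\<integral>\<^sup>+y\<in>B. ennreal (g (y - T x)) \<partial>lborel) * indicator A x)"
      by (simp add: mult_ac)
  qed
  also have "\<dots> = (\<integral>\<^sup>+x\<in>A. (\<integral>\<^sup>+y\<in>B. ennreal (g (y - T x)) \<partial>lborel) \<partial>distr M borel X)"
    unfolding dX by (rule nn_integral_density[symmetric]) measurable
  finally show "emeasure M {\<omega> \<in> space M. X \<omega> \<in> A \<and> Y \<omega> \<in> B}
      = (\<integral>\<^sup>+x\<in>A. (\<integral>\<^sup>+y\<in>B. ennreal (g (y - T x)) \<partial>lborel) \<partial>distr M borel X)" .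
qed

section \<open>Joint law of the independent sources\<close>

text \<open>
  Boxes form an intersection-stable generator of the Borel sets.
\<close>

lemma measure_eqI_box:
  fixes M N :: "'a::euclidean_space measure"
  assumes sets: "sets M = sets borel" "sets N = sets borel"
    and fin: "finite_measure M"
    and eq: "\<And>l u. emeasure M (box l u) = emeasure N (box l u)"
  shows "M = N"
proof (rule measure_eqI_generator_eq)
  let ?E = "range (\<lambda>(a, b). box a b::'a set)"
  show "Int_stable ?E" by (auto simp: Int_stable_def box_Int_box)
  show "?E \<subseteq> Pow UNIV" "sets M = sigma_sets UNIV ?E" "sets N = sigma_sets UNIV ?E"
    by (simp_all add: borel_eq_box sets)
  let ?A = "\<lambda>n::nat. box (- (real n *\<^sub>R One)) (real n *\<^sub>R One) :: 'a set"
  show "range ?A \<subseteq> ?E" "(\<Union>i. ?A i) = UNIV" unfolding UN_box_eq_UNIV by auto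
  show "emeasure M (?A i) \<noteq> \<infinity>" for i using finite_measure.emeasure_finite[OF fin] by auto
  show "emeasure M X = emeasure N X" if "X \<in> ?E" for X using that eq by auto
qed

lemma emeasure_density_product_Times:
  fixes f :: "'a::euclidean_space \<Rightarrow> ennreal" and g :: "'b::euclidean_space \<Rightarrow> ennreal"
  assumes [measurable]: "f \<in> borel_measurable borel" "g \<in> borel_measurable borel"
    "A \<in> sets borel" "B \<in> sets borel"
  shows "emeasure (density lborel (\<lambda>(x, y). f x * g y)) (A \<times> B)
    = emeasure (density lborel f) A * emeasure (density lborel g) B"
proof -
  have "emeasure (density lborel (\<lambda>(x, y). f x * g y)) (A \<times> B)
      = (\<integral>\<^sup>+p. f (fst p) * g (snd p) * indicator (A \<times> B) p \<partial>(lborel \<Otimes>\<^sub>M lborel))"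
    unfolding lborel_prod[symmetric] by (subst emeasure_density) (auto simp: case_prod_beta)
  also have "\<dots> = (\<integral>\<^sup>+x. \<integral>\<^sup>+y. (f x * indicator A x) * (g y * indicator B y) \<partial>lborel \<partial>lborel)"
    by (subst lborel.nn_integral_fst[symmetric]) (auto simp: indicator_times mult_ac)
  also have "\<dots> = emeasure (density lborel f) A * emeasure (density lborel g) B"
    by (simp add: nn_integral_cmult nn_integral_multc emeasure_density)
  finally show ?thesis .
qed

text \<open>
  Fubini's theorem for \<open>N\<close> factors, with the coordinates indexed by the type \<open>'n\<close> instead of the
  canonical basis.
\<close>

lemma nn_integral_lborel_vec_prod:
  fixes h :: "'n::finite \<Rightarrow> real \<Rightarrow> ennreal"
  assumes [measurable]: "\<And>j. h j \<in> borel_measurable borel"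
  shows "(\<integral>\<^sup>+w. (\<Prod>j\<in>UNIV. h j (w $ j)) \<partial>(lborel :: (real^'n) measure)) = (\<Prod>j\<in>UNIV. \<integral>\<^sup>+x. h j x \<partial>lborel)"
proof -
  let ?e = "\<lambda>j::'n. axis j (1::real)"
  have inj: "inj ?e" by (simp add: inj_def axis_eq_axis)
  have B: "(Basis :: (real^'n) set) = range ?e" by (auto simp: Basis_vec_def)
  let ?h = "\<lambda>b. h (inv ?e b)"
  have "(\<integral>\<^sup>+w. (\<Prod>b\<in>Basis. ?h b (w \<bullet> b)) \<partial>lborel) = (\<Prod>b\<in>Basis. (\<integral>\<^sup>+x. ?h b x \<partial>lborel))"
    by (rule nn_integral_lborel_prod) auto
  then show ?thesis by (simp add: B prod.reindex[OF inj] inv_f_f[OF inj] inner_axis)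
qed

lemma emeasure_density_vec_prod_box:
  fixes h :: "'n::finite \<Rightarrow> real \<Rightarrow> ennreal" and l u :: "real^'n"
  assumes [measurable]: "\<And>j. h j \<in> borel_measurable borel"
  shows "emeasure (density lborel (\<lambda>w. \<Prod>j\<in>UNIV. h j (w $ j))) (box l u)
    = (\<Prod>j\<in>UNIV. emeasure (density lborel (h j)) (box (l $ j) (u $ j)))"
proof -
  have ind: "indicator (box l u) w = (\<Prod>j\<in>UNIV. indicator (box (l $ j) (u $ j)) (w $ j) :: ennreal)" for w
    by (auto simp: indicator_def mem_box_cart prod_zero_iff mem_box)
  have "emeasure (density lborel (\<lambda>w. \<Prod>j\<in>UNIV. h j (w $ j))) (box l u)
      = (\<integral>\<^sup>+w. (\<Prod>j\<in>UNIV. h j (w $ j) * indicator (box (l $ j) (u $ j)) (w $ j)) \<partial>lborel)"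
    by (subst emeasure_density) (auto simp: ind prod.distrib)
  also have "\<dots> = (\<Prod>j\<in>UNIV. \<integral>\<^sup>+x. h j x * indicator (box (l $ j) (u $ j)) x \<partial>lborel)"
    by (rule nn_integral_lborel_vec_prod) measurable
  finally show ?thesis by (simp add: emeasure_density)
qed

lemma box_Pair_eq: "box (a, c) (b, d) = box a b \<times> box c d"
  by (auto simp: box_def Basis_prod_def ball_Un)

lemma prod_option_option:
  fixes F :: "'n::finite option option \<Rightarrow> 'a::comm_monoid_mult"
  shows "(\<Prod>i\<in>UNIV. F i) = F None * (F (Some None) * (\<Prod>j\<in>UNIV. F (Some (Some j))))"
proof -
  have "(\<Prod>i\<in>UNIV. G i) = G None * (\<Prod>j\<in>UNIV. G (Some j))"
    for G :: "'b::finite option \<Rightarrow> 'a"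
    by (simp add: UNIV_option_conv prod.reindex)
  from this[of F] this[of "\<lambda>i. F (Some i)"] show ?thesis by simp
qed

text \<open>
  It suffices to compare the two measures on boxes.  A box in the product space prescribes an
  interval for \<open>W0\<close>, one for each \<open>W j\<close>, and a box for \<open>L\<close>; its probability is the product of
  the single probabilities by independence, and the product density integrates over it to the same
  product.
\<close>

lemma joint_distributed_of_source_events:
  fixes L :: "'a \<Rightarrow> real^'n" and W0 :: "'a \<Rightarrow> real" and W :: "'n \<Rightarrow> 'a \<Rightarrow> real"
  assumes "prob_space M" and L: "distributed M lborel L f" and W0: "distributed M lborel W0 g"
    and W: "\<And>j. distributed M lborel (W j) (h j)"
    and indep: "prob_space.indep_sets M (source_events M L W0 W) UNIV"
  shows "distributed M lborel (\<lambda>\<omega>. (L \<omega>, W0 \<omega>, \<chi> j. W j \<omega>))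
    (\<lambda>(x, v, w). f x * (g v * (\<Prod>j\<in>UNIV. h j (w $ j))))"
proof -
  interpret prob_space M by fact
  have [measurable]: "f \<in> borel_measurable borel" "L \<in> borel_measurable M"
    using distributed_borel_measurable[OF L] distributed_measurable[OF L] by simp_all
  have [measurable]: "g \<in> borel_measurable borel" "W0 \<in> borel_measurable M"
    using distributed_borel_measurable[OF W0] distributed_measurable[OF W0] by simp_all
  have [measurable]: "h j \<in> borel_measurable borel" "W j \<in> borel_measurable M" for j
    using distributed_borel_measurable[OF W] distributed_measurable[OF W] by simp_all
  have [measurable]: "(\<lambda>\<omega>. \<chi> j. W j \<omega>) \<in> borel_measurable M"
    by (subst borel_measurable_euclidean_space) (auto simp: Basis_vec_def inner_axis)
  have [measurable]: "(\<lambda>w :: real^'n. w $ j) \<in> borel_measurable borel" for j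
    by (intro borel_measurable_continuous_onI continuous_intros)
  have Wh: "(\<lambda>w :: real^'n. \<Prod>j\<in>UNIV. h j (w $ j)) \<in> borel_measurable borel" by measurable
  have gW: "(\<lambda>(v, w :: real^'n). g v * (\<Prod>j\<in>UNIV. h j (w $ j))) \<in> borel_measurable borel"
    unfolding borel_prod[symmetric] by measurable
  let ?X = "\<lambda>\<omega>. (L \<omega>, W0 \<omega>, \<chi> j. W j \<omega>)"
  let ?d = "\<lambda>(x, p). f x * (\<lambda>(v, w). g v * (\<Prod>j\<in>UNIV. h j (w $ j))) p"
  have X: "?X \<in> borel_measurable M" by measurable
  have d: "?d \<in> borel_measurable borel"
    using gW unfolding borel_prod[symmetric] by measurable
  have pre: "emeasure (density lborel q) A = emeasure M (Y -` A \<inter> space M)"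
    if "distributed M lborel Y q" "A \<in> sets borel" for Y :: "'a \<Rightarrow> 'y::euclidean_space" and q A
    unfolding distributed_distr_eq_density[OF that(1), symmetric]
    using distributed_measurable[OF that(1)] that(2) by (intro emeasure_distr) auto
  have "distr M lborel ?X = density lborel ?d"
  proof (rule measure_eqI_box)
    show "finite_measure (distr M lborel ?X)" using X by (intro finite_measure_distr) simp
    fix l u :: "(real^'n) \<times> real \<times> (real^'n)"
    obtain l1 l2 l3 u1 u2 u3 where lu: "l = (l1, l2, l3)" "u = (u1, u2, u3)" by (metis surj_pair)
    have box: "box l u = box l1 u1 \<times> box l2 u2 \<times> box l3 u3"
      by (simp add: lu box_Pair_eq)
    \<comment> \<open>One event for each source, so that the box is the intersection of all of them.\<close>
    define E where "E i = (case i of None \<Rightarrow> L -` box l1 u1 \<inter> space M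
      | Some None \<Rightarrow> W0 -` box l2 u2 \<inter> space M
      | Some (Some j) \<Rightarrow> W j -` box (l3 $ j) (u3 $ j) \<inter> space M)" for i
    have E: "E i \<in> source_events M L W0 W i" for i
      unfolding E_def source_events_def
      by (cases i; cases "the i") (auto intro!: in_vimage_algebra)
    have "?X -` box l u \<inter> space M = (\<Inter>i. E i)"
    proof (intro set_eqI iffI)
      fix \<omega> assume "\<omega> \<in> (\<Inter>i. E i)"
      then have "\<omega> \<in> E None" "\<omega> \<in> E (Some None)" "\<And>j. \<omega> \<in> E (Some (Some j))" by auto
      then show "\<omega> \<in> ?X -` box l u \<inter> space M" by (auto simp: E_def box mem_box_cart mem_box)
    qed (auto simp: E_def box mem_box_cart mem_box split: option.split)
    then have "emeasure (distr M lborel ?X) (box l u) = emeasure M (\<Inter>i. E i)"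
      using X by (subst emeasure_distr) auto
    also have "\<dots> = (\<Prod>i\<in>UNIV. emeasure M (E i))"
      using indep_setsD[OF indep, of UNIV E] E by (simp add: emeasure_eq_measure prod_ennreal)
    also have "\<dots> = emeasure M (L -` box l1 u1 \<inter> space M) * (emeasure M (W0 -` box l2 u2 \<inter> space M) *
        (\<Prod>j\<in>UNIV. emeasure M (W j -` box (l3 $ j) (u3 $ j) \<inter> space M)))"
      by (simp add: prod_option_option E_def)
    also have "\<dots> = emeasure (density lborel f) (box l1 u1) * (emeasure (density lborel g) (box l2 u2) *
        (\<Prod>j\<in>UNIV. emeasure (density lborel (h j)) (box (l3 $ j) (u3 $ j))))"
      by (simp add: pre[OF L] pre[OF W0] pre[OF W])
    also have "\<dots> = emeasure (density lborel ?d) (box l u)"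
      unfolding box using gW Wh
      by (simp add: emeasure_density_product_Times emeasure_density_vec_prod_box borel_Times)
    finally show "emeasure (distr M lborel ?X) (box l u) = emeasure (density lborel ?d) (box l u)" .
  qed auto
  then have "distributed M lborel ?X ?d" using X d by (simp add: distributed_def)
  moreover have "?d = (\<lambda>(x, v, w). f x * (g v * (\<Prod>j\<in>UNIV. h j (w $ j))))" by (simp add: fun_eq_iff)
  ultimately show ?thesis by simp
qed

lemma nn_integral_distributed_eq_1:
  assumes "prob_space M" and X: "distributed M lborel X f"
  shows "(\<integral>\<^sup>+x. f x \<partial>lborel) = 1"
proof -
  interpret prob_space M by fact
  have "emeasure M (X -` UNIV \<inter> space M) = (\<integral>\<^sup>+x. f x * indicator UNIV x \<partial>lborel)"
    by (rule distributed_emeasure[OF X]) simp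
  then show ?thesis by (simp add: emeasure_space_1)
qed

section \<open>The posterior density and its maximiser\<close>

definition noise_density :: "real \<Rightarrow> real \<Rightarrow> real \<times> (real^'n) \<Rightarrow> real" where
  "noise_density \<sigma>0 b = (\<lambda>(v, w). normal_density 0 \<sigma>0 v * (\<Prod>j\<in>UNIV. laplace_density b (w $ j)))"

lemma continuous_on_multi_normal_density: "continuous_on UNIV (multi_normal_density m P)"
  unfolding multi_normal_density_def divide_inverse
  by (intro continuous_intros
      continuous_on_compose2[OF matrix_vector_mult_linear_continuous_on[of UNIV "matrix_inv P"]]) auto

lemma continuous_on_noise_density: "continuous_on UNIV (noise_density \<sigma>0 b :: real \<times> (real^'n) \<Rightarrow> real)"
  unfolding noise_density_def normal_density_def laplace_density_def case_prod_unfold divide_inverse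
  by (intro continuous_intros)

lemma noise_density_exp:
  "noise_density \<sigma>0 b (v, w :: real^'n)
    = exp (- (v\<^sup>2 / (2 * \<sigma>0\<^sup>2) + 1 / b * norm_1 w)) / (sqrt (2 * pi * \<sigma>0\<^sup>2) * (2 * b) ^ CARD('n))"
proof -
  have "(\<Prod>j\<in>UNIV. laplace_density b (w $ j)) = (\<Prod>j\<in>UNIV. exp (- \<bar>w $ j\<bar> / b)) / (2 * b) ^ CARD('n)"
    by (simp add: laplace_density_def prod_dividef)
  also have "(\<Prod>j\<in>UNIV. exp (- \<bar>w $ j\<bar> / b)) = exp (- (1 / b * norm_1 w))"
    by (simp add: exp_sum[symmetric] norm_1_def sum_negf sum_divide_distrib)
  finally have laplace: "(\<Prod>j\<in>UNIV. laplace_density b (w $ j))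
    = exp (- (1 / b * norm_1 w)) / (2 * b) ^ CARD('n)" .
  have "exp (- (v\<^sup>2 / (2 * \<sigma>0\<^sup>2) + 1 / b * norm_1 w))
      = exp (- v\<^sup>2 / (2 * \<sigma>0\<^sup>2)) * exp (- (1 / b * norm_1 w))"
    by (simp only: exp_add[symmetric] minus_add_distrib minus_divide_left)
  then show ?thesis
    by (simp only: noise_density_def normal_density_def laplace prod.case diff_zero) simp
qed

lemma is_arg_max_exp_neg:
  assumes C: "0 < C" and F: "\<And>x. F x = C * exp (- J x :: real)"
  shows "is_arg_max F (\<lambda>_. True) = is_arg_min J (\<lambda>_. True)"
  using C by (simp add: fun_eq_iff is_arg_max_def is_arg_min_def F)

theorem proposition2:
  fixes M :: "'a measure"
    and m :: "real^'n" and P :: "real^'n^'n" and \<sigma>0 b :: real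
    and L :: "'a \<Rightarrow> real^'n" and W0 :: "'a \<Rightarrow> real" and W :: "'n \<Rightarrow> 'a \<Rightarrow> real"
    and Z0 :: "'a \<Rightarrow> real" and Z :: "'a \<Rightarrow> real^'n"
    and z0 :: real and z :: "real^'n"
  assumes "prob_space M"
    and "spd_matrix P" and "0 < \<sigma>0" and "0 < b"
    and "distributed M lborel L (\<lambda>l. ennreal (multi_normal_density m P l))"
    and "distributed M lborel W0 (\<lambda>w. ennreal (normal_density 0 \<sigma>0 w))"
    and "\<And>j. distributed M lborel (W j) (\<lambda>w. ennreal (laplace_density b w))"
    and "prob_space.indep_sets M (source_events M L W0 W) UNIV"
    and "\<And>\<omega>. \<omega> \<in> space M \<Longrightarrow> Z0 \<omega> = 1 \<bullet> L \<omega> + W0 \<omega>"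
    and "\<And>\<omega> j. \<omega> \<in> space M \<Longrightarrow> Z \<omega> $ j = L \<omega> $ j + W j \<omega>"
  shows "let Y = (\<lambda>\<omega>. (Z0 \<omega>, Z \<omega>));
             J = (\<lambda>l. (z0 - 1 \<bullet> l)\<^sup>2 / (2 * \<sigma>0\<^sup>2)
                      + 1 / 2 * (norm (matrix_inv (spd_sqrt P) *v (l - m)))\<^sup>2
                      + 1 / b * norm_1 (z - l))
         in MAP_estimate M L Y (z0, z) = arg_min J (\<lambda>_. True)
            \<and> (\<exists>!l. is_arg_max (MAP_objective M L Y (z0, z)) (\<lambda>_. True) l)
            \<and> (\<exists>!l. is_arg_min J (\<lambda>_. True) l)"
proof -
  interpret prob_space M by fact
  define f where "f = multi_normal_density m P"
  define g where "g = (noise_density \<sigma>0 b :: real \<times> (real^'n) \<Rightarrow> real)"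
  define T where "T = (\<lambda>l :: real^'n. (1 \<bullet> l, l))"
  define V where "V = (\<lambda>\<omega>. (W0 \<omega>, \<chi> j. W j \<omega>))"
  define Y where "Y = (\<lambda>\<omega>. (Z0 \<omega>, Z \<omega>))"
  define J where "J = (\<lambda>l. (z0 - 1 \<bullet> l)\<^sup>2 / (2 * \<sigma>0\<^sup>2)
    + 1 / 2 * (norm (matrix_inv (spd_sqrt P) *v (l - m)))\<^sup>2 + 1 / b * norm_1 (z - l))"
  have L: "distributed M lborel L (\<lambda>l. ennreal (f l))" using assms(5) by (simp add: f_def)
  have f: "continuous_on UNIV f" unfolding f_def by (rule continuous_on_multi_normal_density)
  have f_pos: "0 < f l" for l
    unfolding f_def multi_normal_density_def
    using spd_matrix_det_pos[OF assms(2)] by (intro divide_pos_pos) auto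
  have h: "0 \<le> laplace_density b x" for x using assms(4) by (simp add: laplace_density_def)
  have g_nn: "0 \<le> g v" for v
    by (cases v) (auto simp: g_def noise_density_def h intro!: mult_nonneg_nonneg prod_nonneg)
  have g_ennreal: "ennreal (g (v, w))
      = ennreal (normal_density 0 \<sigma>0 v) * (\<Prod>j\<in>UNIV. ennreal (laplace_density b (w $ j)))" for v w
    by (simp add: g_def noise_density_def ennreal_mult prod_nonneg h prod_ennreal)
  have cont_g: "continuous_on UNIV g" unfolding g_def by (rule continuous_on_noise_density)
  have cont_T: "continuous_on UNIV T" unfolding T_def by (intro continuous_intros)
  have [measurable]: "g \<in> borel_measurable borel" "T \<in> borel_measurable borel"
    using cont_g cont_T by (auto intro: borel_measurable_continuous_onI)
  have LV: "distributed M lborel (\<lambda>\<omega>. (L \<omega>, V \<omega>)) (\<lambda>(l, v). ennreal (f l) * ennreal (g v))"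
    using joint_distributed_of_source_events[OF assms(1) L assms(6-8)]
    unfolding V_def by (simp add: case_prod_unfold g_ennreal[of "fst p" "snd p" for p, simplified])
  have "(\<lambda>\<omega>. (L \<omega>, V \<omega>)) \<in> M \<rightarrow>\<^sub>M (borel \<Otimes>\<^sub>M borel)"
    using distributed_measurable[OF LV] by (simp add: borel_prod)
  from measurable_compose[OF this measurable_snd]
  have [measurable]: "V \<in> borel_measurable M" by simp
  have [measurable]: "L \<in> borel_measurable M" using distributed_measurable[OF L] by simp
  have Y_eq: "Y \<omega> = V \<omega> + T (L \<omega>)" if "\<omega> \<in> space M" for \<omega>
    using assms(9,10)[OF that] by (simp add: Y_def V_def T_def vec_eq_iff)
  have Y: "Y \<in> borel_measurable M"
    by (subst measurable_cong[OF Y_eq]) measurable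
  have g1: "(\<integral>\<^sup>+v. ennreal (g v) \<partial>lborel) = 1"
  proof -
    have "(\<integral>\<^sup>+v. ennreal (g v) \<partial>lborel) = (\<integral>\<^sup>+p. ennreal (g p) \<partial>(lborel \<Otimes>\<^sub>M lborel))"
      by (simp add: lborel_prod)
    also have "\<dots> = (\<integral>\<^sup>+v. \<integral>\<^sup>+w. ennreal (g (v, w)) \<partial>lborel \<partial>lborel)"
      by (rule lborel.nn_integral_fst[symmetric]) (simp add: lborel_prod)
    also have "\<dots> = (\<integral>\<^sup>+v. ennreal (normal_density 0 \<sigma>0 v) \<partial>lborel)
        * (\<Prod>j\<in>(UNIV :: 'n set). \<integral>\<^sup>+x. ennreal (laplace_density b x) \<partial>lborel)"
      using distributed_borel_measurable[OF assms(7)]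
      unfolding g_ennreal
      by (subst nn_integral_lborel_vec_prod[symmetric])
        (auto simp: nn_integral_cmult nn_integral_multc)
    also have "\<dots> = 1"
      by (simp add: nn_integral_distributed_eq_1[OF assms(1) assms(6)]
          nn_integral_distributed_eq_1[OF assms(1) assms(7)])
    finally show ?thesis .
  qed
  \<comment> \<open>The observation is the noise \<open>V\<close> shifted by \<open>T L\<close>.\<close>
  have "is_cond_density M L Y (\<lambda>l y. g (y - T l))"
    by (rule is_cond_density_additive_noise[OF assms(1) L LV])
       (auto simp: g_nn g1 Y_eq)
  moreover have "continuous_on UNIV (\<lambda>(l, y). g (y - T l))"
    unfolding case_prod_unfold
    by (intro continuous_on_compose2[OF cont_g] continuous_intros continuous_on_compose2[OF cont_T]) auto
  ultimately have cond: "cond_density M L Y = (\<lambda>l y. g (y - T l))"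
    by (intro cond_density_eq[OF assms(1) L f f_pos Y])
  have prior: "prior_density M L = f"
    using f f_pos L by (intro prior_density_eq[OF assms(1)]) (auto intro: less_imp_le)
  \<comment> \<open>The product of the normalising constants of the normal noise, the Laplace noise and the prior.\<close>
  define C where "C = 1 / (sqrt (2 * pi * \<sigma>0\<^sup>2) * (2 * b) ^ CARD('n) * sqrt ((2 * pi) ^ CARD('n) * det P))"
  have C: "0 < C" using assms(3,4) spd_matrix_det_pos[OF assms(2)] by (simp add: C_def)
  have obj: "MAP_objective M L Y (z0, z) l = C * exp (- J l)" for l
  proof -
    define a where "a = (z0 - 1 \<bullet> l)\<^sup>2 / (2 * \<sigma>0\<^sup>2) + 1 / b * norm_1 (z - l)"
    define q where "q = (norm (matrix_inv (spd_sqrt P) *v (l - m)))\<^sup>2"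
    have "J l = a + q / 2" by (simp add: J_def a_def q_def)
    moreover have "g ((z0, z) - T l) = exp (- a) / (sqrt (2 * pi * \<sigma>0\<^sup>2) * (2 * b) ^ CARD('n))"
      by (simp add: g_def T_def noise_density_exp a_def)
    moreover have "f l = exp (- q / 2) / sqrt ((2 * pi) ^ CARD('n) * det P)"
      by (simp add: f_def multi_normal_density_def q_def norm_inverse_sqrt_eq_quadratic_form[OF assms(2)])
    moreover have "exp (- (a + q / 2)) = exp (- a) * exp (- q / 2)" by (simp flip: exp_add)
    ultimately show ?thesis by (simp add: MAP_objective_def cond prior C_def)
  qed
  have argmax: "is_arg_max (MAP_objective M L Y (z0, z)) (\<lambda>_. True) = is_arg_min J (\<lambda>_. True)"
    by (rule is_arg_max_exp_neg[OF C obj])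
  have "\<exists>!l. is_arg_min J (\<lambda>_. True) l"
  proof -
    \<comment> \<open>The criterion without its prior term.\<close>
    define h where "h l = (1 / (2 * \<sigma>0\<^sup>2)) * (z0 - 1 \<bullet> l)\<^sup>2 + (1 / b) * norm_1 (z - l)" for l
    have "convex_on UNIV h" unfolding h_def using assms(3,4)
      by (intro convex_on_add convex_on_cmul convex_square_affine convex_norm_1) auto
    moreover have "0 \<le> h l" for l
      using assms(3,4) by (auto simp: h_def norm_1_def intro!: add_nonneg_nonneg sum_nonneg)
    moreover have "spd_sqrt P ** matrix_inv (spd_sqrt P) = mat 1"
      by (rule spd_matrix_right_inverse[OF spd_sqrt_properties(1)[OF assms(2)]])
    ultimately have "\<exists>!l. is_arg_min (\<lambda>l. h l + 1 / 2 * (norm (matrix_inv (spd_sqrt P) *v (l - m)))\<^sup>2) (\<lambda>_. True) l"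
      by (rule ex1_minimizer_convex_plus_quadratic)
    moreover have "J = (\<lambda>l. h l + 1 / 2 * (norm (matrix_inv (spd_sqrt P) *v (l - m)))\<^sup>2)"
      by (simp add: J_def h_def fun_eq_iff)
    ultimately show ?thesis by simp
  qed
  then show ?thesis
    unfolding Let_def Y_def[symmetric] J_def[symmetric]
    by (simp add: MAP_estimate_def arg_max_def arg_min_def argmax)
qed

end
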